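(* Let $q$ be a prime power and $n,d$ positive integers. Let $\mathcal{P}$ be a set of points in $\mathbb{F}_q^{n+d}$ and $\mathcal{F}$ a set of $n$-flats (affine subspaces of dimension $n$) in $\mathbb{F}_q^{n+d}$. Then, if $d\ge2$, $$\left|I(\mathcal{P},\mathcal{F})-\frac{|\mathcal{P}||\mathcal{F}|}{q^d}\right|\le q^{n/2}\sqrt{|\mathcal{P}||\mathcal{F}|}\left(\frac{|\mathcal{F}|}{q}+\frac{\binom{n+d}{d}_q}{q^{dn}}\right)^{1/2},$$ and if $d=1$, $$\left|I(\mathcal{P},\mathcal{F})-\frac{|\mathcal{P}||\mathcal{F}|}{q}\right|\le q^{n/2}\left(1-\frac1q\right)\sqrt{|\mathcal{P}||\mathcal{F}|}\left(\frac{\binom{n+1}{1}_q}{q^n}\right)^{1/2}.$$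
   Context: $I(\mathcal{P},\mathcal{F})$ denotes the number of pairs $(\mathbf{p},F)\in\mathcal{P}\times\mathcal{F}$ with $\mathbf{p}\in F$. For integers $m\ge k\ge1$, $\binom{m}{k}_q=\prod_{i=0}^{k-1}\frac{q^{m-i}-1}{q^{k-i}-1}$ is the Gaussian binomial coefficient. *)

theory Defs
  imports "HOL-Analysis.Analysis" "HOL-Number_Theory.Prime_Powers"
begin

text \<open>The constant \<^const>\<open>affine\<close> of the library is restricted to real vector spaces, so
  flats over an arbitrary field are defined here as translates of linear subspaces.\<close>

definition is_flat :: "nat \<Rightarrow> ('k::field ^ 'm) set \<Rightarrow> bool" where
  "is_flat n F \<longleftrightarrow> (\<exists>a V. vec.subspace V \<and> vec.dim V = n \<and> F = (+) a ` V)"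

definition incidences :: "'p set \<Rightarrow> 'p set set \<Rightarrow> nat" where
  "incidences P \<F> = card {(p, F). p \<in> P \<and> F \<in> \<F> \<and> p \<in> F}"

text \<open>Only meaningful for \<open>q > 1\<close> and \<open>k \<le> m\<close>, where no subtraction of naturals truncates.\<close>

definition gauss_binomial :: "nat \<Rightarrow> nat \<Rightarrow> nat \<Rightarrow> real" where
  "gauss_binomial q m k =
     (\<Prod>i<k. (real q ^ (m - i) - 1) / (real q ^ (k - i) - 1))"

end

theory Submission
  imports Defs
begin

text \<open>Let \<open>r p\<close> be the number of members of \<open>\<F>\<close> through the point \<open>p\<close>. Since \<open>r\<close> has mean
  \<open>card \<F> / q ^ d\<close>, the deviation of the number of incidences is the inner product of the centred
  indicator function of \<open>P\<close> with the centred function \<open>r\<close>. In the Cauchy-Schwarz inequality the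
  first factor is \<open>card P * (1 - card P / q ^ (n + d))\<close>, and the second is computed from
  the pairwise intersections, which have at most \<open>q ^ (n - 1)\<close> points for distinct flats. The
  gain \<open>1 - 1 / q ^ (n + 1)\<close> in the first factor is what makes the sharp constant for \<open>d = 1\<close>
  come out.\<close>

section \<open>Double counting and second moments of point degrees\<close>

lemma incidences_eq_sum:
  fixes P :: "'p::finite set"
  shows "incidences P \<F> = (\<Sum>p\<in>P. card {F\<in>\<F>. p \<in> F})"
proof -
  have "{(p, F). p \<in> P \<and> F \<in> \<F> \<and> p \<in> F} = Sigma P (\<lambda>p. {F\<in>\<F>. p \<in> F})"
    by auto
  then show ?thesis
    unfolding incidences_def by (simp add: card_SigmaI)
qed

lemma card_Collect_eq_sum:
  assumes "finite A"
  shows "real (card {x\<in>A. Q x}) = (\<Sum>x\<in>A. of_bool (Q x))"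
  using assms by (simp add: Int_def conj_commute)

lemma sum_degree:
  fixes \<F> :: "'p::finite set set"
  assumes "\<And>F. F \<in> \<F> \<Longrightarrow> card F = K"
  shows "(\<Sum>p\<in>UNIV. real (card {F\<in>\<F>. p \<in> F})) = real (card \<F>) * real K"
proof -
  have "(\<Sum>p\<in>UNIV. real (card {F\<in>\<F>. p \<in> F})) = (\<Sum>p\<in>UNIV. \<Sum>F\<in>\<F>. of_bool (p \<in> F))"
    by (simp only: card_Collect_eq_sum finite)
  also have "\<dots> = (\<Sum>F\<in>\<F>. \<Sum>p\<in>UNIV. of_bool (p \<in> F))"
    by (rule sum.swap)
  also have "\<dots> = (\<Sum>F\<in>\<F>. real (card F))"
    by simp
  finally show ?thesis
    using assms by simp
qed

text \<open>Expanding the square counts, for each point, the ordered pairs \<open>(F, G)\<close>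
  through it. After the sums are exchanged, each pair contributes
  \<open>card (F \<inter> G)\<close>: exactly \<open>K\<close> on the diagonal and at most
  \<open>L\<close> off it.\<close>

lemma sum_degree_squared_le:
  fixes \<F> :: "'p::finite set set"
  assumes "\<And>F. F \<in> \<F> \<Longrightarrow> card F = K"
    and "\<And>F G. F \<in> \<F> \<Longrightarrow> G \<in> \<F> \<Longrightarrow> F \<noteq> G \<Longrightarrow> card (F \<inter> G) \<le> L"
  shows "(\<Sum>p\<in>UNIV. (real (card {F\<in>\<F>. p \<in> F}))\<^sup>2)
    \<le> real (card \<F>) * (real K - real L + real (card \<F>) * real L)"
proof -
  have "(\<Sum>p\<in>UNIV. (real (card {F\<in>\<F>. p \<in> F}))\<^sup>2)
      = (\<Sum>p\<in>UNIV. \<Sum>F\<in>\<F>. \<Sum>G\<in>\<F>. of_bool (p \<in> F \<inter> G))"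
    by (simp only: card_Collect_eq_sum finite power2_eq_square sum_product Int_iff
        of_bool_conj)
  also have "\<dots> = (\<Sum>F\<in>\<F>. \<Sum>p\<in>UNIV. \<Sum>G\<in>\<F>. of_bool (p \<in> F \<inter> G))"
    by (rule sum.swap)
  also have "\<dots> = (\<Sum>F\<in>\<F>. \<Sum>G\<in>\<F>. \<Sum>p\<in>UNIV. of_bool (p \<in> F \<inter> G))"
    by (intro sum.cong refl sum.swap)
  also have "\<dots> = (\<Sum>F\<in>\<F>. \<Sum>G\<in>\<F>. real (card (F \<inter> G)))"
    by (simp add: Int_def)
  \<comment> \<open>One expression covers both cases: it equals \<open>real K\<close> when
    \<open>G = F\<close> and \<open>real L\<close> otherwise.\<close>
  also have "\<dots> \<le> (\<Sum>F\<in>\<F>. \<Sum>G\<in>\<F>. real L + of_bool (G = F) * (real K - real L))"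
    using assms by (intro sum_mono) auto
  also have "\<dots> = (\<Sum>F\<in>\<F>. real (card \<F>) * real L + (real K - real L))"
    by (intro sum.cong) (auto simp: sum.distrib of_bool_def if_distrib[of "\<lambda>x. x * _"] cong: if_cong)
  finally show ?thesis
    by (simp add: algebra_simps)
qed

text \<open>This is the variance identity, with \<open>S / CARD('p)\<close> as the mean. It is
  applied both to the indicator function of \<open>P\<close> and to the degree function.\<close>

lemma sum_squared_deviation:
  fixes f :: "'p::finite \<Rightarrow> real"
  assumes "(\<Sum>p\<in>UNIV. f p) = S"
  shows "(\<Sum>p\<in>UNIV. (f p - S / CARD('p))\<^sup>2) = (\<Sum>p\<in>UNIV. (f p)\<^sup>2) - S\<^sup>2 / CARD('p)"
proof -
  let ?N = "real CARD('p)"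
  have "(f p - m)\<^sup>2 = (f p)\<^sup>2 - 2 * m * f p + m\<^sup>2" for p m
    by (simp add: power2_diff)
  then have "(\<Sum>p\<in>UNIV. (f p - m)\<^sup>2)
      = (\<Sum>p\<in>UNIV. (f p)\<^sup>2) - 2 * m * (\<Sum>p\<in>UNIV. f p) + ?N * m\<^sup>2" for m
    by (simp add: sum.distrib sum_subtractf flip: sum_distrib_left)
  \<comment> \<open>At the mean, the linear and constant terms merge into
    \<open>- S^2 / ?N\<close>.\<close>
  from this[of "S / ?N"] show ?thesis
    using assms by (simp add: power2_eq_square)
qed

lemma incidences_deviation_squared_le:
  fixes P :: "'p::finite set"
  assumes "\<And>F. F \<in> \<F> \<Longrightarrow> card F = K"
    and "\<And>F G. F \<in> \<F> \<Longrightarrow> G \<in> \<F> \<Longrightarrow> F \<noteq> G \<Longrightarrow> card (F \<inter> G) \<le> L"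
  shows "(real (incidences P \<F>) - real (card P) * real (card \<F>) * (real K / CARD('p)))\<^sup>2
    \<le> real (card P) * (1 - real (card P) / CARD('p))
      * (real (card \<F>) * (real K - real L + real (card \<F>) * (real L - (real K)\<^sup>2 / CARD('p))))"
proof -
  let ?N = "real CARD('p)" and ?P = "real (card P)" and ?F = "real (card \<F>)"
  define r where "r p = real (card {F\<in>\<F>. p \<in> F})" for p
  define c where "c p = (of_bool (p \<in> P) :: real)" for p
  have r: "(\<Sum>p\<in>UNIV. r p) = ?F * real K"
    unfolding r_def by (rule sum_degree) (rule assms)
  have c: "(\<Sum>p\<in>UNIV. c p) = ?P"
    by (simp add: c_def)
  have "(\<Sum>p\<in>UNIV. c p * r p) = real (incidences P \<F>)"
    by (simp add: incidences_eq_sum c_def r_def of_bool_def if_distrib[of "\<lambda>x. x * _"]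
        flip: sum.inter_filter cong: if_cong)
  \<comment> \<open>With \<open>a\<close> and \<open>b\<close> the means of \<open>c\<close> and
    \<open>r\<close>, the last three terms all have absolute value
    \<open>?P * ?F * real K / ?N\<close>, with signs minus, minus, plus, so a single subtraction
    remains.\<close>
  moreover have "(\<Sum>p\<in>UNIV. (c p - a) * (r p - b))
      = (\<Sum>p\<in>UNIV. c p * r p) - (\<Sum>p\<in>UNIV. c p) * b - a * (\<Sum>p\<in>UNIV. r p) + ?N * (a * b)"
    for a b
    by (simp add: left_diff_distrib right_diff_distrib sum.distrib sum_subtractf
        sum_distrib_left sum_distrib_right)
  ultimately have "real (incidences P \<F>) - ?P * ?F * (real K / ?N)
      = (\<Sum>p\<in>UNIV. (c p - ?P / ?N) * (r p - ?F * real K / ?N))"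
    by (simp add: r c)
  then have "(real (incidences P \<F>) - ?P * ?F * (real K / ?N))\<^sup>2
      \<le> (\<Sum>p\<in>UNIV. (c p - ?P / ?N)\<^sup>2) * (\<Sum>p\<in>UNIV. (r p - ?F * real K / ?N)\<^sup>2)"
    by (simp only: Cauchy_Schwarz_ineq_sum)
  also have "(\<Sum>p\<in>UNIV. (c p - ?P / ?N)\<^sup>2) = ?P * (1 - ?P / ?N)"
  proof -
    \<comment> \<open>An indicator function equals its own square.\<close>
    have "(\<Sum>p\<in>UNIV. (c p)\<^sup>2) = ?P"
      by (simp add: c_def power2_eq_square flip: of_bool_conj)
    then show ?thesis
      unfolding sum_squared_deviation[OF c] by (simp add: algebra_simps power2_eq_square)
  qed
  also have "?P * (1 - ?P / ?N) * (\<Sum>p\<in>UNIV. (r p - ?F * real K / ?N)\<^sup>2)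
      \<le> ?P * (1 - ?P / ?N) * (?F * (real K - real L + ?F * (real L - (real K)\<^sup>2 / ?N)))"
  proof (rule mult_left_mono)
    have "(\<Sum>p\<in>UNIV. (r p)\<^sup>2) \<le> ?F * (real K - real L + ?F * real L)"
      unfolding r_def by (rule sum_degree_squared_le) (use assms in auto)
    then show "(\<Sum>p\<in>UNIV. (r p - ?F * real K / ?N)\<^sup>2)
        \<le> ?F * (real K - real L + ?F * (real L - (real K)\<^sup>2 / ?N))"
      unfolding sum_squared_deviation[OF r] by (simp add: algebra_simps power2_eq_square)
    have "?P \<le> ?N"
      by (simp add: card_mono)
    then show "0 \<le> ?P * (1 - ?P / ?N)"
      by simp
  qed
  finally show ?thesis .
qed

section \<open>Sizes of subspaces, flats and their intersections\<close>

text \<open>Each new independent vector \<open>b\<close> multiplies the size by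
  \<open>CARD('k)\<close>, because \<open>(k, v)\<close> maps bijectively to
  \<open>k *s b + v\<close>. If two different coefficients gave the same vector, dividing by their
  difference would put \<open>b\<close> into \<open>vec.span B\<close>.\<close>

lemma card_span_independent:
  fixes B :: "('k::{field,finite} ^ 'm::finite) set"
  assumes "finite B" "vec.independent B"
  shows "card (vec.span B) = CARD('k) ^ card B"
  using assms
proof (induction B rule: finite_induct)
  case empty
  then show ?case by simp
next
  case (insert b B)
  then have ind: "vec.independent B" and b: "b \<notin> vec.span B"
    by (auto simp: vec.independent_insert)
  let ?f = "\<lambda>(k, v). k *s b + v"
  have "inj_on ?f (UNIV \<times> vec.span B)"
  proof (rule inj_onI, clarsimp)
    fix k l v w
    assume v: "v \<in> vec.span B" and w: "w \<in> vec.span B" and eq: "k *s b + v = l *s b + w"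
    have "k = l"
    proof (rule ccontr)
      assume "k \<noteq> l"
      have "(k - l) *s b = w - v"
        using eq by (simp add: vec.scale_left_diff_distrib algebra_simps)
      then have "(k - l) *s b \<in> vec.span B"
        using v w by (simp add: vec.span_diff)
      then show False
        using b \<open>k \<noteq> l\<close> vec.span_scale[of "(k - l) *s b" B "inverse (k - l)"]
        by (simp del: vec.scale_left_diff_distrib vector_sub_rdistrib)
    qed
    then show "k = l \<and> v = w"
      using eq by simp
  qed
  moreover have "?f ` (UNIV \<times> vec.span B) = vec.span (insert b B)"
  proof (intro set_eqI iffI)
    fix x assume "x \<in> vec.span (insert b B)"
    then obtain k where "x - k *s b \<in> vec.span B"
      by (auto simp: vec.span_insert)
    then show "x \<in> ?f ` (UNIV \<times> vec.span B)"
      by (intro image_eqI[of _ _ "(k, x - k *s b)"]) auto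
  next
    fix x assume "x \<in> ?f ` (UNIV \<times> vec.span B)"
    then obtain k v where "x = k *s b + v" "v \<in> vec.span B"
      by auto
    then show "x \<in> vec.span (insert b B)"
      by (auto simp: vec.span_insert intro!: exI[of _ k])
  qed
  ultimately have "card (vec.span (insert b B)) = card ((UNIV :: 'k set) \<times> vec.span B)"
    by (metis card_image)
  then show ?case
    using insert ind by (simp add: card_cartesian_product)
qed

lemma card_subspace:
  fixes V :: "('k::{field,finite} ^ 'm::finite) set"
  assumes "vec.subspace V"
  shows "card V = CARD('k) ^ vec.dim V"
proof -
  obtain B where B: "B \<subseteq> V" "vec.independent B" "V \<subseteq> vec.span B" "card B = vec.dim V"
    using vec.basis_exists by blast
  then have "vec.span B = V"
    using assms vec.span_minimal by blast
  then show ?thesis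
    using card_span_independent[of B] B by simp
qed

lemma card_flat:
  fixes F :: "('k::{field,finite} ^ 'm::finite) set"
  assumes "is_flat n F"
  shows "card F = CARD('k) ^ n"
  using assms by (auto simp: is_flat_def card_image card_subspace)

text \<open>Any point of a flat can serve as its base point. Two flats that meet can thus be
  translated by the same vector, which reduces their intersection to one of linear
  subspaces.\<close>

lemma flat_through_point:
  assumes "is_flat n F" "x \<in> F"
  obtains V where "vec.subspace V" "vec.dim V = n" "F = (+) x ` V"
proof -
  obtain a V where V: "vec.subspace V" "vec.dim V = n" "F = (+) a ` V"
    using assms by (auto simp: is_flat_def)
  then obtain v where v: "v \<in> V" "x = a + v"
    using assms by auto
  have "(+) a ` V = (+) x ` V"
  proof (intro equalityI subsetI)
    fix y assume "y \<in> (+) a ` V"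
    then obtain w where "w \<in> V" "y = a + w" by auto
    then show "y \<in> (+) x ` V"
      using v V by (intro image_eqI[of _ _ "w - v"]) (auto simp: vec.subspace_diff)
  next
    fix y assume "y \<in> (+) x ` V"
    then obtain w where "w \<in> V" "y = x + w" by auto
    then show "y \<in> (+) a ` V"
      using v V by (intro image_eqI[of _ _ "v + w"]) (auto simp: vec.subspace_add add.assoc)
  qed
  then show ?thesis
    using V that by metis
qed

text \<open>Flats with a common point and equal directions coincide, so the directions of distinct
  ones differ. Their intersection is then a proper subspace of each and has dimension below
  \<open>n\<close>.\<close>

lemma card_flat_Int_le:
  fixes F G :: "('k::{field,finite} ^ 'm::finite) set"
  assumes "is_flat n F" "is_flat n G" "F \<noteq> G"
  shows "card (F \<inter> G) \<le> CARD('k) ^ (n - 1)"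
proof (cases "F \<inter> G = {}")
  case False
  then obtain x where x: "x \<in> F" "x \<in> G" by auto
  obtain V where V: "vec.subspace V" "vec.dim V = n" "F = (+) x ` V"
    using flat_through_point assms x by metis
  obtain W where W: "vec.subspace W" "vec.dim W = n" "G = (+) x ` W"
    using flat_through_point assms x by metis
  have sub: "vec.subspace (V \<inter> W)"
    using V W by (simp add: vec.subspace_inter)
  \<comment> \<open>This also forces \<open>n > 0\<close> when the flats meet, so
    \<open>n - 1\<close> does not truncate here.\<close>
  have "\<not> n \<le> vec.dim (V \<inter> W)"
  proof
    assume "n \<le> vec.dim (V \<inter> W)"
    then have "V \<inter> W = V" "V \<inter> W = W"
      using V W sub by (metis Int_lower1 Int_lower2 vec.subspace_dim_equal)+
    then show False
      using assms V W by auto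
  qed
  moreover have "F \<inter> G = (+) x ` (V \<inter> W)"
    using V W by (auto simp: image_Int)
  ultimately show ?thesis
    using sub by (auto simp: card_image card_subspace intro!: power_increasing)
qed simp

section \<open>Gaussian binomials and the bounds for flats\<close>

text \<open>With \<open>j = d - i\<close>, each of the \<open>d\<close> factors is at least
  \<open>q^n\<close>, since
  \<open>q^n * (q^j - 1) = q^(n+j) - q^n \<le> q^(n+j) - 1\<close>.\<close>

lemma gauss_binomial_ge:
  assumes "q > 1"
  shows "real q ^ (d * n) \<le> gauss_binomial q (n + d) d"
proof -
  have "(\<Prod>i<d. real q ^ n) \<le> gauss_binomial q (n + d) d"
    unfolding gauss_binomial_def
  proof (intro prod_mono conjI)
    fix i assume "i \<in> {..<d}"
    then have i: "n + d - i = n + (d - i)" "d - i > 0" by auto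
    have "real q ^ (d - i) > 1"
      using assms i by (intro one_less_power) auto
    moreover have "real q ^ n \<ge> 1"
      using assms by simp
    ultimately show "real q ^ n \<le> (real q ^ (n + d - i) - 1) / (real q ^ (d - i) - 1)"
      unfolding i(1) power_add by (simp add: field_simps)
  qed simp
  then show ?thesis
    by (simp add: power_mult mult.commute flip: power_mult)
qed

theorem theorem1p8:
  fixes P :: "('k::{field,finite} ^ 'm::finite) set"
    and \<F> :: "('k ^ 'm) set set"
    and q n d :: nat
  assumes "primepow q" and "CARD('k) = q"
    and "n \<ge> 1" and "d \<ge> 1"
    and "CARD('m) = n + d"
    and "\<And>F. F \<in> \<F> \<Longrightarrow> is_flat n F"
  shows "(d \<ge> 2 \<longrightarrow>
      \<bar>real (incidences P \<F>) - real (card P) * real (card \<F>) / real q ^ d\<bar>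
        \<le> real q powr (real n / 2) * sqrt (real (card P) * real (card \<F>))
            * sqrt (real (card \<F>) / real q + gauss_binomial q (n + d) d / real q ^ (d * n)))
    \<and> (d = 1 \<longrightarrow>
      \<bar>real (incidences P \<F>) - real (card P) * real (card \<F>) / real q\<bar>
        \<le> real q powr (real n / 2) * (1 - 1 / real q)
            * sqrt (real (card P) * real (card \<F>))
            * sqrt (gauss_binomial q (n + 1) 1 / real q ^ n))"
proof -
  let ?P = "real (card P)" and ?F = "real (card \<F>)" and ?q = "real q"
  define X where "X = real (incidences P \<F>) - ?P * ?F / ?q ^ d"
  have q: "q > 1"
    using assms(1) primepow_gt_Suc_0 by auto
  have N: "real CARD('k ^ 'm) = ?q ^ (n + d)"
    using assms by simp
  have K: "?q ^ n / ?q ^ (n + d) = 1 / ?q ^ d" "(?q ^ n)\<^sup>2 / ?q ^ (n + d) = ?q ^ n / ?q ^ d"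
    using q by (auto simp: power_add power2_eq_square)
  have L: "?q ^ (n - 1) = ?q ^ n / ?q"
    using q assms(3) by (simp add: power_diff)
  have "card F = q ^ n" if "F \<in> \<F>" for F
    using card_flat assms(2,6) that by blast
  moreover have "card (F \<inter> G) \<le> q ^ (n - 1)" if "F \<in> \<F>" "G \<in> \<F>" "F \<noteq> G" for F G
    using card_flat_Int_le assms(2,6) that by blast
  ultimately have "(real (incidences P \<F>) - ?P * ?F * (real (q ^ n) / CARD('k ^ 'm)))\<^sup>2
    \<le> ?P * (1 - ?P / CARD('k ^ 'm))
      * (?F * (real (q ^ n) - real (q ^ (n - 1))
          + ?F * (real (q ^ (n - 1)) - (real (q ^ n))\<^sup>2 / CARD('k ^ 'm))))"
    by (rule incidences_deviation_squared_le)
  then have X: "X\<^sup>2 \<le> ?P * (1 - ?P / ?q ^ (n + d))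
      * (?F * (?q ^ n - ?q ^ n / ?q + ?F * (?q ^ n / ?q - ?q ^ n / ?q ^ d)))"
    unfolding X_def N of_nat_power K L by simp
  have "card P \<le> CARD('k ^ 'm)"
    by (rule card_mono) auto
  then have P: "?P / ?q ^ (n + d) \<le> 1"
    using q N by (simp flip: N)
  \<comment> \<open>Both bounds are established in squared form; \<open>root\<close> removes the
    squares at the end.\<close>
  have root: "\<bar>X\<bar> \<le> b" if "X\<^sup>2 \<le> b\<^sup>2" "b \<ge> 0" for b
    using that by (simp add: abs_le_square_iff[symmetric])
  have half: "(?q powr (real n / 2))\<^sup>2 = ?q ^ n"
    using q by (simp add: powr_powr powr_realpow flip: powr_numeral)
  have g: "gauss_binomial q (n + d) d / ?q ^ (d * n) \<ge> 1"
    using gauss_binomial_ge[OF q, of d n] q by (simp add: field_simps)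
  show ?thesis
  proof (intro conjI impI)
    assume "d \<ge> 2"
    let ?g = "gauss_binomial q (n + d) d / ?q ^ (d * n)"
    \<comment> \<open>Three losses are accepted: \<open>1 - ?P / ?q ^ (n + d)\<close> is raised to
      1, the diagonal term to \<open>?q ^ n * ?g\<close>, and the negative term
      \<open>- ?q ^ n / ?q ^ d\<close> is dropped.\<close>
    have "X\<^sup>2 \<le> (?P * 1) * (?F * (?q ^ n * (?F / ?q + ?g)))"
    proof (rule order_trans[OF X], intro mult_mono mult_left_mono)
      have "?q ^ n - ?q ^ n / ?q \<le> ?q ^ n * 1"
        by simp
      also have "\<dots> \<le> ?q ^ n * ?g"
        using g by (intro mult_left_mono) auto
      finally have "?q ^ n - ?q ^ n / ?q \<le> ?q ^ n * ?g" .
      moreover have "?F * (?q ^ n / ?q - ?q ^ n / ?q ^ d) \<le> ?F * (?q ^ n / ?q)"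
        by (intro mult_left_mono) auto
      ultimately show "?q ^ n - ?q ^ n / ?q + ?F * (?q ^ n / ?q - ?q ^ n / ?q ^ d)
          \<le> ?q ^ n * (?F / ?q + ?g)"
        by (simp add: distrib_left mult_ac)
      have "?q ^ 1 \<le> ?q ^ d"
        using q \<open>d \<ge> 2\<close> by (intro power_increasing) auto
      then have "?q ^ n / ?q ^ d \<le> ?q ^ n / ?q"
        using q by (intro divide_left_mono) auto
      moreover have "?q ^ n / ?q \<le> ?q ^ n / 1"
        using q by (intro divide_left_mono) auto
      ultimately show "0 \<le> ?q ^ n - ?q ^ n / ?q + ?F * (?q ^ n / ?q - ?q ^ n / ?q ^ d)"
        by simp
      then show "0 \<le> ?F * (?q ^ n - ?q ^ n / ?q + ?F * (?q ^ n / ?q - ?q ^ n / ?q ^ d))"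
        by simp
    qed (use P in auto)
    also have "\<dots> = (?q powr (real n / 2) * sqrt (?P * ?F) * sqrt (?F / ?q + ?g))\<^sup>2"
      using g by (simp add: power_mult_distrib half mult_ac)
    finally have "\<bar>X\<bar> \<le> ?q powr (real n / 2) * sqrt (?P * ?F) * sqrt (?F / ?q + ?g)"
      using g by (intro root) auto
    then show "\<bar>real (incidences P \<F>) - ?P * ?F / ?q ^ d\<bar>
        \<le> ?q powr (real n / 2) * sqrt (?P * ?F) * sqrt (?F / ?q + ?g)"
      by (simp add: X_def)
  next
    assume d: "d = 1"
    let ?g = "gauss_binomial q (n + 1) 1 / ?q ^ n"
    have g: "?g \<ge> 1"
      using g d by simp
    \<comment> \<open>For \<open>d = 1\<close> the coefficient
      \<open>?q ^ n / ?q - ?q ^ n / ?q ^ d\<close> vanishes, so only the diagonal term survives. In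
      the first factor, either \<open>P\<close> is empty and both sides are zero, or
      \<open>card P\<close> is at least 1.\<close>
    have "X\<^sup>2 \<le> (?P * (1 - 1 / ?q ^ (n + 1))) * (?F * (?q ^ n - ?q ^ n / ?q))"
    proof -
      have "?P * (1 - ?P / ?q ^ (n + 1)) \<le> ?P * (1 - 1 / ?q ^ (n + 1))"
      proof (cases "card P = 0")
        case False
        then have "1 \<le> ?P"
          by linarith
        then have "1 / ?q ^ (n + 1) \<le> ?P / ?q ^ (n + 1)"
          by (intro divide_right_mono) auto
        then show ?thesis
          by (intro mult_left_mono) auto
      qed simp
      moreover have "?q ^ n / ?q \<le> ?q ^ n / 1"
        using q by (intro divide_left_mono) auto
      ultimately have "(?P * (1 - ?P / ?q ^ (n + 1))) * (?F * (?q ^ n - ?q ^ n / ?q))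
          \<le> (?P * (1 - 1 / ?q ^ (n + 1))) * (?F * (?q ^ n - ?q ^ n / ?q))"
        by (intro mult_right_mono) auto
      then show ?thesis
        using X d by simp
    qed
    \<comment> \<open>The Gaussian binomial is \<open>(q^(n+1) - 1) / (q - 1)\<close> here, and both
      sides equal \<open>?P * ?F * (q^(n+1) - 1) * (q - 1) / q^2\<close>, so nothing is
      lost.\<close>
    also have "\<dots> = ?q ^ n * (1 - 1 / ?q)\<^sup>2 * (?P * ?F) * ?g"
      using q by (simp add: gauss_binomial_def field_simps power2_eq_square)
    also have "\<dots> = (?q powr (real n / 2) * (1 - 1 / ?q) * sqrt (?P * ?F) * sqrt ?g)\<^sup>2"
      using g by (simp add: power_mult_distrib half)
    finally have "\<bar>X\<bar> \<le> ?q powr (real n / 2) * (1 - 1 / ?q) * sqrt (?P * ?F) * sqrt ?g"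
      using q by (intro root mult_nonneg_nonneg real_sqrt_ge_zero order_trans[OF zero_le_one g]) auto
    then show "\<bar>real (incidences P \<F>) - ?P * ?F / ?q\<bar>
        \<le> ?q powr (real n / 2) * (1 - 1 / ?q) * sqrt (?P * ?F) * sqrt ?g"
      by (simp add: X_def d)
  qed
qed

end
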